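(* Let $\mathcal{H}$ be an infinite-dimensional separable complex Hilbert space, let $B(z)=\tau\prod_{i=1}^{d}\frac{z+\lambda_i}{1+\overline{\lambda_i}z}$ be a finite Blaschke product with $|\tau|=1$ and $\lambda_1,\dots,\lambda_d\in\mathbb{D}$, and let $U$ be a unitary operator on $\mathcal{H}$. Then every Blaschke frame for $B$ with the unitary operator $U$ on $\mathcal{H}$ is a Riesz basis for $\mathcal{H}$.
   Context: $\mathbb{D}$ is the open unit disc in $\mathbb{C}$. For an isometry $V$ on $\mathcal{H}$ (in particular a unitary), $B(V^* )$ is defined by the Riesz-Dunford (rational) functional calculus, i.e. $B(V^* )=\tau\prod_{j=1}^{d}(V^*+\lambda_j 1_{\mathcal{H}})(1_{\mathcal{H}}+\overline{\lambda_j}V^* )^{-1}$. A Blaschke frame for $B$ with isometry $V$ on $\mathcal{H}$ is any sequence $(b_m)_{m=1}^\infty$ of the form $b_m=B(V^* )e_m$ for some orthonormal basis $(e_m)_{m=1}^\infty$ of $\mathcal{H}$. A Riesz basis for $\mathcal{H}$ is a sequence of the form $(Te_m)_{m=1}^\infty$ where $(e_m)_{m=1}^\infty$ is an orthonormal basis of $\mathcal{H}$ and $T$ is a bounded invertible operator on $\mathcal{H}$. *)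

theory Defs
  imports "HOL-Analysis.Analysis"
begin

section \<open>Complex Hilbert spaces\<close>

class complex_vector = real_vector +
  fixes scaleC :: "complex \<Rightarrow> 'a \<Rightarrow> 'a" (infixr "*\<^sub>C" 75)
  assumes scaleC_add_right: "a *\<^sub>C (x + y) = a *\<^sub>C x + a *\<^sub>C y"
    and scaleC_add_left: "(a + b) *\<^sub>C x = a *\<^sub>C x + b *\<^sub>C x"
    and scaleC_scaleC: "a *\<^sub>C b *\<^sub>C x = (a * b) *\<^sub>C x"
    and scaleC_of_real: "complex_of_real r *\<^sub>C x = r *\<^sub>R x"

global_interpretation complex_vector: vector_space "scaleC :: complex \<Rightarrow> 'a \<Rightarrow> 'a :: complex_vector"
  defines cspan = complex_vector.span
proof
  show "1 *\<^sub>C x = x" for x :: 'a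
    using scaleC_of_real[of 1 x] by simp
qed (simp_all add: scaleC_add_right scaleC_add_left scaleC_scaleC)

text \<open>
  The inner product is linear in its first argument. Positivity and definiteness are consequences
  of \<open>norm_eq_sqrt_cinner\<close> and the norm axioms, since \<open>sqrt\<close> is negative on negative reals.
\<close>

class complex_inner = complex_vector + real_normed_vector +
  fixes cinner :: "'a \<Rightarrow> 'a \<Rightarrow> complex"
  assumes cinner_commute: "cinner x y = cnj (cinner y x)"
    and cinner_add_left: "cinner (x + y) z = cinner x z + cinner y z"
    and cinner_scaleC_left: "cinner (c *\<^sub>C x) y = c * cinner x y"
    and norm_eq_sqrt_cinner: "norm x = sqrt (Re (cinner x x))"

class complex_hilbert = complex_inner + complete_space

lemma cinner_ge_zero: "0 \<le> Re (cinner x x)"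
  using norm_ge_zero[of x] by (simp add: norm_eq_sqrt_cinner)

lemma cinner_self: "cinner x x = complex_of_real ((norm x)\<^sup>2)"
proof -
  have "Im (cinner x x) = 0"
    using arg_cong[OF cinner_commute[of x x], of Im] by simp
  moreover have "Re (cinner x x) = (norm x)\<^sup>2"
    using cinner_ge_zero[of x] by (simp add: norm_eq_sqrt_cinner)
  ultimately show ?thesis by (simp add: complex_eq_iff)
qed

lemma cinner_add_right: "cinner x (y + z) = cinner x y + cinner x z"
  by (metis cinner_add_left cinner_commute complex_cnj_add)

lemma cinner_scaleC_right: "cinner x (c *\<^sub>C y) = cnj c * cinner x y"
  by (metis cinner_commute cinner_scaleC_left complex_cnj_mult)

lemma cinner_unique:
  assumes "\<And>x. cinner x y = cinner x z"
  shows "y = z"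
proof -
  have "cinner (y - z) y = cinner (y - z) (y - z) + cinner (y - z) z"
    by (metis cinner_add_right diff_add_cancel)
  then have "cinner (y - z) (y - z) = 0" using assms by simp
  then show ?thesis by (simp add: cinner_self)
qed


section \<open>Operators\<close>

definition clinear :: "('a::complex_vector \<Rightarrow> 'b::complex_vector) \<Rightarrow> bool" where
  "clinear T \<longleftrightarrow> Vector_Spaces.linear (*\<^sub>C) (*\<^sub>C) T"

definition bounded_clinear :: "('a::complex_inner \<Rightarrow> 'b::complex_inner) \<Rightarrow> bool" where
  "bounded_clinear T \<longleftrightarrow> clinear T \<and> (\<exists>K. \<forall>x. norm (T x) \<le> K * norm x)"

definition bounded_invertible :: "('a::complex_inner \<Rightarrow> 'a) \<Rightarrow> bool" where
  "bounded_invertible T \<longleftrightarrow>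
     bounded_clinear T \<and> (\<exists>S. bounded_clinear S \<and> S \<circ> T = id \<and> T \<circ> S = id)"

definition isometry_op :: "('a::complex_inner \<Rightarrow> 'a) \<Rightarrow> bool" where
  "isometry_op V \<longleftrightarrow> clinear V \<and> (\<forall>x. norm (V x) = norm x)"

definition unitary_op :: "('a::complex_inner \<Rightarrow> 'a) \<Rightarrow> bool" where
  "unitary_op U \<longleftrightarrow> isometry_op U \<and> surj U"

text \<open>
  The description is well defined for every bounded operator on a Hilbert space, by the Riesz
  representation theorem; for unitary operators this is \<open>unitary_adjoint\<close> below.
\<close>

definition adjoint_op :: "('a::complex_inner \<Rightarrow> 'a) \<Rightarrow> ('a \<Rightarrow> 'a)" where
  "adjoint_op T = (THE S. \<forall>x y. cinner (T x) y = cinner x (S y))"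

lemma clinear_add: "clinear T \<Longrightarrow> T (x + y) = T x + T y"
  and clinear_scaleC: "clinear T \<Longrightarrow> T (c *\<^sub>C x) = c *\<^sub>C T x"
  by (auto simp: clinear_def Vector_Spaces.linear_def module_hom_def module_hom_axioms_def)

lemma adjoint_op_eqI:
  assumes "\<And>x y. cinner (T x) y = cinner x (S y)"
  shows "adjoint_op T = S"
  unfolding adjoint_op_def
proof (rule the_equality)
  fix S' assume "\<forall>x y. cinner (T x) y = cinner x (S' y)"
  then show "S' = S"
    using assms by (intro ext cinner_unique) metis
qed (use assms in blast)

lemma isometry_cinner:
  assumes "isometry_op V"
  shows "cinner (V x) (V y) = cinner x y"
proof -
  have lin: "clinear V" and nrm: "\<And>z. cinner (V z) (V z) = cinner z z"
    using assms by (auto simp: isometry_op_def cinner_self)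
  have expand: "cinner (a + b) (a + b) = cinner a a + cinner b b + (cinner a b + cnj (cinner a b))"
    for a b :: 'a
    by (simp add: cinner_add_left cinner_add_right) (metis add.assoc add.commute cinner_commute)
  have Re_eq: "Re (cinner (V a) (V b)) = Re (cinner a b)" for a b
  proof -
    have "cinner (V a + V b) (V a + V b) = cinner (a + b) (a + b)"
      using nrm[of "a + b"] by (simp add: clinear_add[OF lin])
    then have "cinner (V a) (V b) + cnj (cinner (V a) (V b)) = cinner a b + cnj (cinner a b)"
      unfolding expand by (simp add: nrm)
    then show ?thesis by (simp add: complex_add_cnj)
  qed
  have "Im (cinner (V x) (V y)) = Im (cinner x y)"
    using Re_eq[of "\<i> *\<^sub>C x" y] by (simp add: clinear_scaleC[OF lin] cinner_scaleC_left)
  with Re_eq show ?thesis by (simp add: complex_eq_iff)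
qed

lemma unitary_adjoint:
  assumes "unitary_op U"
  shows "adjoint_op U = inv U"
proof (rule adjoint_op_eqI)
  have "isometry_op U" and "surj U"
    using assms by (auto simp: unitary_op_def)
  then show "cinner (U x) y = cinner x (inv U y)" for x y
    by (metis isometry_cinner surj_f_inv_f)
qed


section \<open>Orthonormal and Riesz bases\<close>

definition infinite_dimensional :: "'a::complex_vector itself \<Rightarrow> bool" where
  "infinite_dimensional _ \<longleftrightarrow> \<not> (\<exists>F :: 'a set. finite F \<and> cspan F = UNIV)"

definition orthonormal_basis :: "(nat \<Rightarrow> 'a::complex_inner) \<Rightarrow> bool" where
  "orthonormal_basis e \<longleftrightarrow>
     (\<forall>m n. cinner (e m) (e n) = (if m = n then 1 else 0)) \<and>
     closure (cspan (range e)) = UNIV"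

definition riesz_basis :: "(nat \<Rightarrow> 'a::complex_inner) \<Rightarrow> bool" where
  "riesz_basis f \<longleftrightarrow>
     (\<exists>e T. orthonormal_basis e \<and> bounded_invertible T \<and> f = (\<lambda>m. T (e m)))"


section \<open>Finite Blaschke products of operators\<close>

text \<open>
  The Blaschke product \<open>B(z) = \<tau> \<Prod>\<^sub>j (z + l j) / (1 + cnj (l j) z)\<close>, with \<open>j\<close> from \<open>1\<close> to \<open>d\<close>, is given
  by its data \<open>\<tau>\<close>, \<open>d\<close> and \<open>l\<close>, and \<open>blaschke_op \<tau> d l T\<close> is the operator \<open>B(T)\<close>. The map inverted
  below is a bijection when \<open>T\<close> is a linear contraction and all \<open>l j\<close> lie in the open unit disc.
\<close>

definition blaschke_factor :: "complex \<Rightarrow> ('a::complex_vector \<Rightarrow> 'a) \<Rightarrow> ('a \<Rightarrow> 'a)" where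
  "blaschke_factor c T = (\<lambda>x. T x + c *\<^sub>C x) \<circ> inv (\<lambda>x. x + cnj c *\<^sub>C T x)"

definition blaschke_op ::
    "complex \<Rightarrow> nat \<Rightarrow> (nat \<Rightarrow> complex) \<Rightarrow> ('a::complex_vector \<Rightarrow> 'a) \<Rightarrow> ('a \<Rightarrow> 'a)" where
  "blaschke_op \<tau> d l T =
     (\<lambda>x. \<tau> *\<^sub>C foldr (\<circ>) (map (\<lambda>j. blaschke_factor (l j) T) [1..<Suc d]) id x)"

lemma blaschke_factor_scalar:
  assumes "1 + cnj c * z \<noteq> 0"
  shows "blaschke_factor c (\<lambda>x. z *\<^sub>C x) = (\<lambda>x. ((z + c) / (1 + cnj c * z)) *\<^sub>C x)"
proof -
  have *: "(\<lambda>x::'a. x + cnj c *\<^sub>C z *\<^sub>C x) = (\<lambda>x. (1 + cnj c * z) *\<^sub>C x)"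
    by (simp add: scaleC_add_left scaleC_scaleC)
  have "inv (\<lambda>x::'a. (1 + cnj c * z) *\<^sub>C x) = (\<lambda>x. (1 / (1 + cnj c * z)) *\<^sub>C x)"
    using assms by (intro inv_equality) (simp_all add: scaleC_scaleC)
  then show ?thesis
    unfolding blaschke_factor_def *
    by (simp add: fun_eq_iff scaleC_scaleC flip: scaleC_add_left add_divide_distrib)
qed

text \<open>On multiplication by a scalar \<open>z\<close>, the operator \<open>B(T)\<close> is multiplication by \<open>B(z)\<close>.\<close>

lemma blaschke_op_scalar:
  assumes "\<And>j. j \<in> {1..d} \<Longrightarrow> 1 + cnj (l j) * z \<noteq> 0"
  shows "blaschke_op \<tau> d l (\<lambda>x. z *\<^sub>C x) =
    (\<lambda>x. (\<tau> * (\<Prod>j = 1..d. (z + l j) / (1 + cnj (l j) * z))) *\<^sub>C x)"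
proof -
  have fold: "foldr (\<circ>) (map (\<lambda>j. blaschke_factor (l j) (\<lambda>x. z *\<^sub>C x)) js) id =
      (\<lambda>x::'a. (\<Prod>j\<leftarrow>js. (z + l j) / (1 + cnj (l j) * z)) *\<^sub>C x)"
    if "set js \<subseteq> {1..d}" for js
    using that
  proof (induction js)
    case (Cons j js)
    then show ?case
      by (simp add: blaschke_factor_scalar assms fun_eq_iff scaleC_scaleC)
  qed (simp add: fun_eq_iff)
  have "(\<Prod>j\<leftarrow>[1..<Suc d]. (z + l j) / (1 + cnj (l j) * z)) =
      (\<Prod>j = 1..d. (z + l j) / (1 + cnj (l j) * z))"
    by (subst prod.distinct_set_conv_list[symmetric])
      (simp_all only: distinct_upt set_upt atLeastLessThanSuc_atLeastAtMost)
  moreover have "set [1..<Suc d] \<subseteq> {1..d}" by auto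
  ultimately show ?thesis
    unfolding blaschke_op_def fold[OF \<open>set [1..<Suc d] \<subseteq> {1..d}\<close>]
    by (simp only: scaleC_scaleC)
qed

definition blaschke_frame ::
    "complex \<Rightarrow> nat \<Rightarrow> (nat \<Rightarrow> complex) \<Rightarrow> ('a::complex_inner \<Rightarrow> 'a) \<Rightarrow> (nat \<Rightarrow> 'a) \<Rightarrow> bool" where
  "blaschke_frame \<tau> d l V b \<longleftrightarrow>
     (\<exists>e. orthonormal_basis e \<and> b = (\<lambda>m. blaschke_op \<tau> d l (adjoint_op V) (e m)))"

end

theory Submission
  imports Defs
begin

text \<open>
  More is true than the theorem says: \<open>B(U\<^sup>*)\<close> is unitary, so that the Blaschke frame is the image
  of an orthonormal basis under a unitary, and in particular bounded and boundedly invertible,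
  operator.

  A finite Blaschke product maps the unit circle, where the spectrum of \<open>U\<^sup>*\<close> lies, into itself.
  The proof carries this out for each factor without the spectral theorem. For a linear isometry \<open>W\<close>
  the identity \<open>norm (W x + c x) = norm (x + cnj c W x)\<close> is the operator version of
  \<open>\<bar>z + c\<bar> = \<bar>1 + cnj c z\<bar>\<close> for \<open>\<bar>z\<bar> = 1\<close> (\<open>isometry_norm_add_scaleC_swap\<close>), and it makes every
  factor isometric. The operator \<open>1 + c W\<close> is bijective for \<open>\<bar>c\<bar> < 1\<close> by Banach's fixed point
  theorem (\<open>isometry_bij_id_add\<close>). Hence the denominator of a factor can be inverted; and its
  numerator \<open>W + c = W (1 + c W\<inverse>)\<close> is surjective if \<open>W\<close> is unitary. So every factor is unitary, and
  unitary operators are closed under composition and under multiplication by \<open>\<tau>\<close>.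
\<close>

section \<open>Linear maps and the norm\<close>

lemma clinearI:
  assumes "\<And>x y. T (x + y) = T x + T y" and "\<And>c x. T (c *\<^sub>C x) = c *\<^sub>C T x"
  shows "clinear T"
  unfolding clinear_def Vector_Spaces.linear_def module_hom_def module_hom_axioms_def
  by (intro conjI allI complex_vector.vector_space_axioms complex_vector.module_axioms assms)

lemma clinear_diff: "clinear T \<Longrightarrow> T (x - y) = T x - T y"
  by (metis add_diff_cancel_right' clinear_add diff_add_cancel)

lemma clinear_id_add: "clinear T \<Longrightarrow> clinear (\<lambda>x. x + c *\<^sub>C T x)"
  by (rule clinearI)
    (simp_all add: clinear_add clinear_scaleC scaleC_add_right scaleC_scaleC mult.commute)

lemma clinear_add_id: "clinear T \<Longrightarrow> clinear (\<lambda>x. T x + c *\<^sub>C x)"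
  by (rule clinearI)
    (simp_all add: clinear_add clinear_scaleC scaleC_add_right scaleC_scaleC mult.commute)

lemma clinear_compose: "clinear S \<Longrightarrow> clinear T \<Longrightarrow> clinear (S \<circ> T)"
  by (rule clinearI) (simp_all add: clinear_add clinear_scaleC)

lemma clinear_inv:
  assumes "clinear T" and "bij T"
  shows "clinear (inv T)"
proof (rule clinearI)
  have inj: "inj T" and T_inv: "T (inv T x) = x" for x
    using assms(2) by (simp_all add: bij_is_inj bij_is_surj surj_f_inv_f)
  show "inv T (x + y) = inv T x + inv T y" for x y
    by (rule inv_f_eq[OF inj]) (simp add: clinear_add[OF assms(1)] T_inv)
  show "inv T (c *\<^sub>C x) = c *\<^sub>C inv T x" for c x
    by (rule inv_f_eq[OF inj]) (simp add: clinear_scaleC[OF assms(1)] T_inv)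
qed

lemma norm_scaleC: "norm (c *\<^sub>C x) = cmod c * norm (x :: 'a::complex_inner)"
proof -
  have "complex_of_real ((norm (c *\<^sub>C x))\<^sup>2) = c * cnj c * complex_of_real ((norm x)\<^sup>2)"
    by (simp only: cinner_self[symmetric] cinner_scaleC_left cinner_scaleC_right mult_ac)
  also have "\<dots> = complex_of_real ((cmod c * norm x)\<^sup>2)"
    by (simp only: complex_norm_square[symmetric] of_real_mult[symmetric] power_mult_distrib)
  finally have "(norm (c *\<^sub>C x))\<^sup>2 = (cmod c * norm x)\<^sup>2"
    using of_real_eq_iff by blast
  then show ?thesis by simp
qed

lemma norm_add_squared:
  "(norm (x + y :: 'a::complex_inner))\<^sup>2 = (norm x)\<^sup>2 + (norm y)\<^sup>2 + 2 * Re (cinner x y)"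
proof -
  have "Re (cinner y x) = Re (cinner x y)"
    by (subst cinner_commute) simp
  moreover have sq: "(norm z)\<^sup>2 = Re (cinner z z)" for z :: 'a
    by (simp add: cinner_self)
  ultimately show ?thesis
    unfolding sq by (simp add: cinner_add_left cinner_add_right)
qed


section \<open>Unitary operators\<close>

lemma unitary_opI:
  assumes "clinear U" and "\<And>x. norm (U x) = norm x" and "surj U"
  shows "unitary_op U"
  using assms by (simp add: unitary_op_def isometry_op_def)

lemma unitary_op_clinear: "unitary_op U \<Longrightarrow> clinear U"
  and unitary_op_norm: "unitary_op U \<Longrightarrow> norm (U x) = norm x"
  by (simp_all add: unitary_op_def isometry_op_def)

lemma unitary_op_bij:
  assumes "unitary_op U"
  shows "bij U"
proof (rule bijI)
  show "inj U"
  proof (rule injI)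
    fix x y assume "U x = U y"
    then have "norm (U (x - y)) = 0"
      using assms by (simp add: clinear_diff unitary_op_clinear)
    then show "x = y" using assms by (simp add: unitary_op_norm)
  qed
  show "surj U" using assms by (simp add: unitary_op_def)
qed

lemma unitary_op_inv:
  assumes "unitary_op U"
  shows "unitary_op (inv U)"
proof (rule unitary_opI)
  have bij: "bij U" using assms by (rule unitary_op_bij)
  show "clinear (inv U)"
    using assms bij by (simp add: clinear_inv unitary_op_clinear)
  show "norm (inv U x) = norm x" for x
    using assms bij by (metis bij_inv_eq_iff unitary_op_norm)
  show "surj (inv U)"
    using bij by (simp add: bij_imp_bij_inv bij_is_surj)
qed

lemma unitary_op_id: "unitary_op id"
  by (rule unitary_opI) (simp_all add: clinearI)

lemma unitary_op_compose:
  assumes "unitary_op U" and "unitary_op V"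
  shows "unitary_op (U \<circ> V)"
proof (rule unitary_opI)
  show "clinear (U \<circ> V)"
    using assms by (intro clinear_compose unitary_op_clinear)
  show "norm ((U \<circ> V) x) = norm x" for x
    using assms by (simp add: unitary_op_norm)
  show "surj (U \<circ> V)"
    using assms by (intro comp_surj) (simp_all add: unitary_op_def)
qed

lemma unitary_op_scaleC:
  assumes "cmod c = 1"
  shows "unitary_op (\<lambda>x :: 'a::complex_inner. c *\<^sub>C x)"
proof (rule unitary_opI)
  show "clinear (\<lambda>x :: 'a. c *\<^sub>C x)"
    by (rule clinearI) (simp_all add: scaleC_add_right scaleC_scaleC mult.commute)
  show "norm (c *\<^sub>C x) = norm x" for x :: 'a
    using assms by (simp add: norm_scaleC)
  have "x = c *\<^sub>C (1 / c) *\<^sub>C x" for x :: 'a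
    using assms by (auto simp: scaleC_scaleC)
  then show "surj (\<lambda>x :: 'a. c *\<^sub>C x)" by (rule surjI[OF sym])
qed

lemma unitary_op_bounded_invertible:
  assumes "unitary_op U"
  shows "bounded_invertible U"
proof -
  have bounded: "bounded_clinear V" if "unitary_op V" for V :: "'a \<Rightarrow> 'a"
    unfolding bounded_clinear_def
    using that by (auto simp: unitary_op_clinear unitary_op_norm intro!: exI[of _ 1])
  have "inv U \<circ> U = id" and "U \<circ> inv U = id"
    using unitary_op_bij[OF assms] by (simp_all add: bij_is_inj bij_is_surj surj_iff[symmetric])
  then show ?thesis
    unfolding bounded_invertible_def
    using bounded[OF assms] bounded[OF unitary_op_inv[OF assms]] by blast
qed


section \<open>Blaschke products of unitary operators\<close>

text \<open>
  Both sides have square \<open>(1 + \<bar>c\<bar>\<^sup>2) (norm x)\<^sup>2 + 2 Re (cnj c \<langle>W x, x\<rangle>)\<close>, because \<open>W\<close> preserves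
  norms.
\<close>

lemma isometry_norm_add_scaleC_swap:
  assumes "isometry_op W"
  shows "norm (W x + c *\<^sub>C x) = norm (x + cnj c *\<^sub>C W x)"
proof -
  have norm_W: "norm (W x) = norm x"
    using assms by (simp add: isometry_op_def)
  have "Re (cinner x (cnj c *\<^sub>C W x)) = Re (cinner (W x) (c *\<^sub>C x))"
    unfolding cinner_scaleC_right by (subst cinner_commute) simp
  then have "(norm (W x + c *\<^sub>C x))\<^sup>2 = (norm (x + cnj c *\<^sub>C W x))\<^sup>2"
    by (simp add: norm_add_squared norm_scaleC norm_W)
  then show ?thesis by simp
qed

text \<open>
  The equation \<open>x + c W x = y\<close> says that \<open>x\<close> is a fixed point of \<open>x \<mapsto> y - c W x\<close>, which is a
  contraction with factor \<open>\<bar>c\<bar>\<close> on a complete space.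
\<close>

lemma isometry_bij_id_add:
  fixes W :: "'a::complex_hilbert \<Rightarrow> 'a"
  assumes W: "isometry_op W" and c: "cmod c < 1"
  shows "bij (\<lambda>x. x + c *\<^sub>C W x)"
proof -
  have "\<exists>!x. y - c *\<^sub>C W x = x" for y
  proof -
    have "dist (y - c *\<^sub>C W u) (y - c *\<^sub>C W v) = cmod c * dist u v" for u v
    proof -
      have "(y - c *\<^sub>C W u) - (y - c *\<^sub>C W v) = c *\<^sub>C W (v - u)"
        using W by (simp add: isometry_op_def clinear_diff complex_vector.scale_right_diff_distrib)
      then have "dist (y - c *\<^sub>C W u) (y - c *\<^sub>C W v) = cmod c * norm (v - u)"
        using W by (simp add: dist_norm norm_scaleC isometry_op_def)
      then show ?thesis by (simp add: dist_norm norm_minus_commute)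
    qed
    then show ?thesis
      using banach_fix_type[of "cmod c" "\<lambda>x. y - c *\<^sub>C W x"] c by simp
  qed
  then have "\<exists>!x. y = x + c *\<^sub>C W x" for y
    by (metis diff_eq_eq)
  then show ?thesis
    by (auto simp: bij_iff) metis
qed

text \<open>
  Factoring out \<open>W\<close> turns the operator into \<open>W (1 + c W\<inverse>)\<close>, where the small coefficient stands at
  an isometry again. For a mere isometry the conclusion fails: take \<open>c = 0\<close> and the unilateral shift.
\<close>

lemma unitary_surj_add_id:
  fixes W :: "'a::complex_hilbert \<Rightarrow> 'a"
  assumes W: "unitary_op W" and c: "cmod c < 1"
  shows "surj (\<lambda>x. W x + c *\<^sub>C x)"
proof -
  have bij: "bij W" using W by (rule unitary_op_bij)
  have "W x + c *\<^sub>C x = (W \<circ> (\<lambda>x. x + c *\<^sub>C inv W x)) x" for x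
    using W bij
    by (simp add: clinear_add clinear_scaleC unitary_op_clinear bij_is_surj surj_f_inv_f)
  moreover have "surj (\<lambda>x. x + c *\<^sub>C inv W x)"
    using isometry_bij_id_add[of "inv W"] unitary_op_inv[OF W] c
    by (simp add: unitary_op_def bij_is_surj)
  ultimately show ?thesis
    using bij by (metis (no_types, lifting) bij_is_surj comp_surj ext)
qed

lemma blaschke_factor_unitary:
  fixes W :: "'a::complex_hilbert \<Rightarrow> 'a"
  assumes W: "unitary_op W" and c: "cmod c < 1"
  shows "unitary_op (blaschke_factor c W)"
proof -
  define N where "N = (\<lambda>x. W x + c *\<^sub>C x)"
  define D where "D = (\<lambda>x. x + cnj c *\<^sub>C W x)"
  have iso: "isometry_op W" using W by (simp add: unitary_op_def)
  have lin: "clinear W" using W by (rule unitary_op_clinear)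
  have D: "bij D"
    unfolding D_def using isometry_bij_id_add[OF iso, of "cnj c"] c by simp
  have "unitary_op (N \<circ> inv D)"
  proof (rule unitary_opI)
    show "clinear (N \<circ> inv D)"
      using D lin unfolding N_def D_def
      by (intro clinear_compose clinear_inv clinear_add_id clinear_id_add)
    show "norm ((N \<circ> inv D) x) = norm x" for x
    proof -
      have "norm (N y) = norm (D y)" for y
        unfolding N_def D_def by (rule isometry_norm_add_scaleC_swap[OF iso])
      then show ?thesis
        using D by (simp add: bij_is_surj surj_f_inv_f)
    qed
    have "surj N"
      unfolding N_def using W c by (rule unitary_surj_add_id)
    then show "surj (N \<circ> inv D)"
      using D by (intro comp_surj) (simp_all add: bij_imp_bij_inv bij_is_surj)
  qed
  then show ?thesis
    by (simp add: blaschke_factor_def N_def D_def)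
qed

lemma blaschke_op_unitary:
  fixes W :: "'a::complex_hilbert \<Rightarrow> 'a"
  assumes \<tau>: "cmod \<tau> = 1" and l: "\<And>j. j \<in> {1..d} \<Longrightarrow> cmod (l j) < 1" and W: "unitary_op W"
  shows "unitary_op (blaschke_op \<tau> d l W)"
proof -
  have "unitary_op (foldr (\<circ>) (map (\<lambda>j. blaschke_factor (l j) W) js) id)"
    if "set js \<subseteq> {1..d}" for js
    using that
  proof (induction js)
    case Nil
    show ?case using unitary_op_id by (simp add: id_def)
  next
    case (Cons j js)
    have "unitary_op (blaschke_factor (l j) W)"
      using Cons.prems l[of j] W by (simp add: blaschke_factor_unitary)
    moreover have "unitary_op (foldr (\<circ>) (map (\<lambda>j. blaschke_factor (l j) W) js) id)"
      by (rule Cons.IH) (use Cons.prems in simp)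
    ultimately have "unitary_op
        (blaschke_factor (l j) W \<circ> foldr (\<circ>) (map (\<lambda>j. blaschke_factor (l j) W) js) id)"
      by (rule unitary_op_compose)
    moreover have "foldr (\<circ>) (map (\<lambda>j. blaschke_factor (l j) W) (j # js)) id =
        blaschke_factor (l j) W \<circ> foldr (\<circ>) (map (\<lambda>j. blaschke_factor (l j) W) js) id"
      by (rule ext) simp
    ultimately show ?case by (rule ssubst[of _ _ unitary_op, rotated])
  qed
  from this[of "[1..<Suc d]"]
  have "unitary_op (foldr (\<circ>) (map (\<lambda>j. blaschke_factor (l j) W) [1..<Suc d]) id)"
    by (simp only: set_upt atLeastLessThanSuc_atLeastAtMost subset_refl)
  from unitary_op_compose[OF unitary_op_scaleC[OF \<tau>] this]
  show ?thesis
    by (simp only: blaschke_op_def comp_def)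
qed

theorem proposition4p8:
  fixes \<tau> :: complex and d :: nat and l :: "nat \<Rightarrow> complex"
    and U :: "'a::complex_hilbert \<Rightarrow> 'a" and b :: "nat \<Rightarrow> 'a"
  assumes "infinite_dimensional TYPE('a)"
    and "separable_space (euclidean :: 'a topology)"
    and "cmod \<tau> = 1"
    and "\<And>j. j \<in> {1..d} \<Longrightarrow> l j \<in> ball 0 1"
    and "unitary_op U"
    and "blaschke_frame \<tau> d l U b"
  shows "riesz_basis b"
proof -
  have "unitary_op (adjoint_op U)"
    using assms(5) by (simp add: unitary_adjoint unitary_op_inv)
  then have "unitary_op (blaschke_op \<tau> d l (adjoint_op U))"
    using assms(3,4) by (intro blaschke_op_unitary) simp_all
  then show ?thesis
    using assms(6) unitary_op_bounded_invertible
    unfolding blaschke_frame_def riesz_basis_def by blast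
qed

end
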